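(* Let $\pi:2^{[n]}\to[0,1]$ be a probability mass function on the subsets of $[n]=\{1,\dots,n\}$ with $\pi(\emptyset)=0$, and consider the discrete-time load balancing system with $n$ servers and service rate vector $\boldsymbol\mu\in\mathbb R_+^n$, $\mu_\Sigma=\sum_{i=1}^n\mu_i>0$, described in the context, operating under the routing algorithm $\mathcal R^\pi$: in each time slot a random set $\mathcal S\subseteq[n]$ of servers is selected with probability $\pi(\mathcal S)$, and all arrivals of the slot are routed to the server in $\mathcal S$ with the shortest queue. Let $\mathcal P([n])$ be the set of permutations of $[n]$. For each $\tau\in\mathcal P([n])$ and $i\in[n]$ let $$\mathcal S_i^\tau=\left\{\mathcal S\subseteq[n]:\ \tau(n-i+1)\in\mathcal S,\ \ \tau(\ell)\notin\mathcal S\ \text{ for all }\ell<n-i+1\right\},$$ and let $$\mathcal M_\tau=\left\{\boldsymbol\mu\in\mathbb R_+^n:\ \frac{\sum_{i=1}^{j}\mu_{(i)}}{\mu_\Sigma}\ \ge\ \sum_{i=1}^{j}\ \sum_{\mathcal S\in\mathcal S_i^\tau}\pi(\mathcal S)\quad\text{for all } j\in[n-1]\right\},$$ where $\mu_{(i)}$ denotes the $i$-th smallest entry of $\boldsymbol\mu$. If $\boldsymbol\mu\in\mathcal M_\tau$ for all $\tau\in\mathcal P([n])$, then $\mathcal R^\pi$ is throughput optimal.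
   Context: Notation: $\mathbb R_+$, $\mathbb Z_+$ are the nonnegative reals and integers. Model. Time is slotted, $k\in\mathbb Z_+$. There are $n$ servers, each with an infinite-buffer queue; $q_i(k)\in\mathbb Z_+$ is the number of jobs in queue $i$ (including any in service) at the beginning of slot $k$, and $\boldsymbol q(k)=(q_1(k),\dots,q_n(k))$. The total number of arrivals in slot $k$ is $a(k)\in\mathbb Z_+$, where $\{a(k)\}$ is i.i.d. with mean $\lambda=\mathbb E[a(1)]$ and finite second moment. In each slot a dispatcher sends all arrivals of that slot to a single queue $i^*$, chosen by a routing algorithm, so $a_{i^*}(k)=a(k)$ and $a_i(k)=0$ for $i\ne i^*$. The potential service vectors $\boldsymbol s(k)\in\mathbb Z_+^n$ are i.i.d. over $k$ (entries within a slot may be dependent), with mean $\boldsymbol\mu=\mathbb E[\boldsymbol s(1)]$ and finite second moments, and are independent of the arrivals; $\boldsymbol s(k)$ is independent of the queue lengths up to slot $k$ and of the routing decision in slot $k$. Arrivals and routing occur before service in each slot, so $$q_i(k+1)=q_i(k)+a_i(k)-s_i(k)+u_i(k),\qquad u_i(k)=\max\{s_i(k)-q_i(k)-a_i(k),0\}.$$ Then $\{\boldsymbol q(k)\}$ is a discrete-time Markov chain. Under $\mathcal R^\pi$ the random set $\mathcal S$ is selected in each slot independently of everything else, queue lengths are compared using $\boldsymbol q(k)$, and ties are broken at random. Capacity region and throughput optimality. The capacity region is $\mathcal C=\{\lambda\in\mathbb R_+:\lambda\le\mu_\Sigma\}$, and its interior is $\mathrm{Int}(\mathcal C)=(0,\mu_\Sigma)$.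 The law of the service process is fixed, and for each $\lambda\in(0,\mu_\Sigma)$ an arrival law with mean $\lambda$ and finite second moment is given. A routing algorithm is throughput optimal if, for every $\lambda\in\mathrm{Int}(\mathcal C)$, the Markov chain $\{\boldsymbol q(k)\}$ of the system operating under that algorithm, with arrival rate $\lambda$, is positive recurrent. As usual when speaking of positive recurrence of a chain, for every $\lambda\in(0,\mu_\Sigma)$ the chain $\{\boldsymbol q(k)\}$ is taken to be irreducible on its (countable) state space, a subset of $\mathbb Z_+^n$. *)

theory Defs
  imports "HOL-Probability.Probability"
begin

text \<open>
  The servers are the elements of a finite type \<open>'n\<close>, so \<open>n = CARD('n)\<close>;
  queue lengths and potential services are vectors in \<open>nat ^ 'n\<close>.
\<close>

text \<open>
  A chain is given by its paths: \<open>X x \<omega> k\<close> is the state at time \<open>k\<close> of the chain started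
  in \<open>x\<close>, on the sample point \<open>\<omega>\<close> of the probability space \<open>M\<close>.
\<close>

text \<open>The infimum is over an empty set, hence \<open>\<infinity>\<close>, if the path does not return.\<close>

definition return_time :: "'x \<Rightarrow> (nat \<Rightarrow> 'x) \<Rightarrow> ennreal" where
  "return_time x p = (INF k\<in>{k. 1 \<le> k \<and> p k = x}. of_nat k)"

definition irreducible_on :: "'w measure \<Rightarrow> ('x \<Rightarrow> 'w \<Rightarrow> nat \<Rightarrow> 'x) \<Rightarrow> 'x set \<Rightarrow> bool" where
  "irreducible_on M X E \<longleftrightarrow>
     E \<noteq> {} \<and>
     (\<forall>x\<in>E. \<forall>k. AE \<omega> in M. X x \<omega> k \<in> E) \<and>
     (\<forall>x\<in>E. \<forall>y\<in>E. \<exists>k. measure M {\<omega> \<in> space M. X x \<omega> k = y} > 0)"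

definition positive_recurrent_on :: "'w measure \<Rightarrow> ('x \<Rightarrow> 'w \<Rightarrow> nat \<Rightarrow> 'x) \<Rightarrow> 'x set \<Rightarrow> bool" where
  "positive_recurrent_on M X E \<longleftrightarrow>
     (\<forall>x\<in>E. (\<integral>\<^sup>+ \<omega>. return_time x (X x \<omega>) \<partial>M) < \<infinity>)"

text \<open>
  The input of a slot consists of the number of arrivals, the vector of potential services and
  the private randomness (of type \<open>'r\<close>) of the routing algorithm. These three are independent of
  each other (the entries of the service vector need not be), and the inputs of different slots
  are i.i.d. A routing algorithm is a distribution \<open>rnd\<close> of its private randomness together with
  a function \<open>route\<close> that turns the current queue lengths and the private randomness into a server.
\<close>

definition input_space ::
  "nat pmf \<Rightarrow> (nat ^ 'n) pmf \<Rightarrow> 'r pmf \<Rightarrow> (nat \<Rightarrow> nat \<times> (nat ^ 'n) \<times> 'r) measure" where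
  "input_space arr serv rnd = (\<Pi>\<^sub>M k\<in>UNIV. measure_pmf (pair_pmf arr (pair_pmf serv rnd)))"

definition routed :: "'n \<Rightarrow> nat \<Rightarrow> nat ^ 'n" where
  "routed i a = (\<chi> j. if j = i then a else 0)"

text \<open>Truncated subtraction on \<open>nat\<close> provides the maximum with \<open>0\<close>.\<close>

definition unused_service :: "nat ^ 'n \<Rightarrow> nat ^ 'n \<Rightarrow> nat ^ 'n \<Rightarrow> nat ^ 'n" where
  "unused_service q a s = (\<chi> i. s $ i - (q $ i + a $ i))"

text \<open>Here the subtraction, carried out last, never truncates.\<close>

definition next_queue :: "nat ^ 'n \<Rightarrow> nat ^ 'n \<Rightarrow> nat ^ 'n \<Rightarrow> nat ^ 'n" where
  "next_queue q a s = (\<chi> i. (q $ i + a $ i + unused_service q a s $ i) - s $ i)"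

lemma next_queue_int:
  "int (next_queue q a s $ i) = int (q $ i) + int (a $ i) - int (s $ i) + int (unused_service q a s $ i)"
  by (simp add: next_queue_def unused_service_def)

lemma unused_service_int:
  "int (unused_service q a s $ i) = max (int (s $ i) - int (q $ i) - int (a $ i)) 0"
  by (simp add: unused_service_def)

primrec queue ::
  "(nat ^ 'n \<Rightarrow> 'r \<Rightarrow> 'n) \<Rightarrow> nat ^ 'n \<Rightarrow> (nat \<Rightarrow> nat \<times> (nat ^ 'n) \<times> 'r) \<Rightarrow> nat \<Rightarrow> nat ^ 'n" where
  "queue route x \<omega> 0 = x"
| "queue route x \<omega> (Suc k) =
     (case \<omega> k of (a, s, r) \<Rightarrow>
        let q = queue route x \<omega> k in next_queue q (routed (route q r) a) s)"

definition service_rate :: "(nat ^ 'n) pmf \<Rightarrow> real ^ 'n" where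
  "service_rate serv = (\<chi> i. measure_pmf.expectation serv (\<lambda>s. real (s $ i)))"

definition total_rate :: "real ^ 'n \<Rightarrow> real" where
  "total_rate \<mu> = (\<Sum>i\<in>UNIV. \<mu> $ i)"

definition capacity_region :: "real ^ 'n \<Rightarrow> real set" where
  "capacity_region \<mu> = {l. 0 \<le> l \<and> l \<le> total_rate \<mu>}"

lemma interior_capacity_region: "interior (capacity_region \<mu>) = {0<..<total_rate \<mu>}"
proof -
  have "capacity_region \<mu> = {0..total_rate \<mu>}" by (auto simp: capacity_region_def)
  then show ?thesis by simp
qed

text \<open>
  \<open>arr l\<close> is the arrival law used at arrival rate \<open>l\<close>, and \<open>E l\<close> is the state space of the
  resulting chain, on which it is irreducible by a separate assumption.
\<close>

definition throughput_optimal ::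
  "(nat ^ 'n) pmf \<Rightarrow> (real \<Rightarrow> nat pmf) \<Rightarrow> (real \<Rightarrow> (nat ^ 'n) set) \<Rightarrow>
   'r pmf \<Rightarrow> (nat ^ 'n \<Rightarrow> 'r \<Rightarrow> 'n) \<Rightarrow> bool" where
  "throughput_optimal serv arr E rnd route \<longleftrightarrow>
     (\<forall>l\<in>interior (capacity_region (service_rate serv)).
        positive_recurrent_on (input_space (arr l) serv rnd) (queue route) (E l))"

definition shortest :: "nat ^ 'n \<Rightarrow> 'n set \<Rightarrow> 'n set" where
  "shortest q S = {i \<in> S. \<forall>j\<in>S. q $ i \<le> q $ j}"

text \<open>
  The private randomness is the selected set together with a tie-breaking function, which maps
  each nonempty set of servers to a uniformly distributed element of it.
\<close>

definition tie_break :: "('n::finite set \<Rightarrow> 'n) pmf" where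
  "tie_break = Pi_pmf {T. T \<noteq> {}} undefined pmf_of_set"

lemma tie_break_uniform: "T \<noteq> {} \<Longrightarrow> map_pmf (\<lambda>c. c T) tie_break = pmf_of_set T"
  by (simp add: tie_break_def Pi_pmf_component)

definition R_rnd :: "'n::finite set pmf \<Rightarrow> ('n set \<times> ('n set \<Rightarrow> 'n)) pmf" where
  "R_rnd \<pi> = pair_pmf \<pi> tie_break"

definition R_route :: "nat ^ 'n \<Rightarrow> 'n set \<times> ('n set \<Rightarrow> 'n) \<Rightarrow> 'n" where
  "R_route q r = (case r of (S, c) \<Rightarrow> c (shortest q S))"

text \<open>A permutation is an enumeration of the servers, \<open>bij_betw \<tau> {1..CARD('n)} UNIV\<close>.\<close>

definition S_tau :: "(nat \<Rightarrow> 'n::finite) \<Rightarrow> nat \<Rightarrow> 'n set set" where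
  "S_tau \<tau> i = {S. \<tau> (CARD('n) - i + 1) \<in> S \<and> (\<forall>l\<in>{1..<CARD('n) - i + 1}. \<tau> l \<notin> S)}"

text \<open>The \<open>i\<close>-th smallest entry, counted with multiplicity and for \<open>1 \<le> i\<close>.\<close>

definition ith_smallest :: "real ^ 'n \<Rightarrow> nat \<Rightarrow> real" where
  "ith_smallest \<mu> i = sorted_list_of_multiset (image_mset (\<lambda>j. \<mu> $ j) (mset_set UNIV)) ! (i - 1)"

definition M_tau :: "'n::finite set pmf \<Rightarrow> (nat \<Rightarrow> 'n) \<Rightarrow> (real ^ 'n) set" where
  "M_tau \<pi> \<tau> =
     {\<mu>. (\<forall>i. 0 \<le> \<mu> $ i) \<and>
          (\<forall>j\<in>{1..CARD('n) - 1}.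
             (\<Sum>i=1..j. ith_smallest \<mu> i) / total_rate \<mu>
               \<ge> (\<Sum>i=1..j. \<Sum>S\<in>S_tau \<tau> i. pmf \<pi> S))}"

end

theory Submission
  imports Defs
begin

text \<open>
  The Lyapunov function is \<open>\<Sum>i. q i ^ 2\<close>. Up to a constant its drift is twice
  \<open>\<lambda> * \<Sum>S. \<pi> S * (min over S of q) - \<Sum>i. \<mu> i * q i\<close>. Written as a sum over the levels
  \<open>t\<close> of the queue lengths, the two terms become sums of \<open>\<lambda> * \<pi> {S. S \<subseteq> A}\<close> and of \<open>\<mu> A\<close>
  over the sets \<open>A = {i. t < q i}\<close>. The membership of \<open>\<mu>\<close> in every \<open>M_tau \<pi> \<tau>\<close> amounts to
  \<open>\<pi> {S. S \<subseteq> A} * total_rate \<mu> \<le> \<mu> A\<close> for all \<open>A\<close> (take \<open>\<tau>\<close> enumerating \<open>A\<close> last), so the drift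
  is at most \<open>C - 2 * (1 - \<lambda> / total_rate \<mu>) * \<Sum>i. \<mu> i * q i\<close>, and Foster's criterion applies.
  A queue without service never decreases, so by irreducibility it is constant on the state
  space; hence the sublevel sets of \<open>\<Sum>i. \<mu> i * q i\<close> are finite there.
\<close>

subsection \<open>Foster's criterion\<close>

text \<open>Tail sum: a first return at time \<open>m\<close> leaves exactly the \<open>m\<close>
  indices \<open>k < m\<close> without a visit during \<open>1..k\<close>. With no return both sides
  are infinite.\<close>

lemma return_time_eq_suminf:
  "return_time x p = (\<Sum>k. indicator {p. \<forall>j\<in>{1..k}. p j \<noteq> x} p :: ennreal)"
proof (cases "\<exists>k\<ge>1. p k = x")
  case False
  then have 1: "{k. 1 \<le> k \<and> p k = x} = {}" by auto
  have 2: "(\<lambda>k. indicator {p. \<forall>j\<in>{1..k}. p j \<noteq> x} p :: ennreal) = (\<lambda>_. 1)"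
    using False by (auto simp: indicator_def fun_eq_iff)
  have "(\<Sum>k. 1 :: ennreal) = top"
    by (simp add: suminf_eq_SUP ennreal_SUP_of_nat_eq_top)
  then show ?thesis unfolding return_time_def 1 2 by simp
next
  case True
  define m where "m = (LEAST k. 1 \<le> k \<and> p k = x)"
  have m: "1 \<le> m" "p m = x" using LeastI_ex[of "\<lambda>k. 1 \<le> k \<and> p k = x"] True by (auto simp: m_def)
  have min: "m \<le> k" if "1 \<le> k" "p k = x" for k using that by (auto simp: m_def intro: Least_le)
  have "return_time x p = of_nat m"
    unfolding return_time_def using m min by (intro antisym INF_lower INF_greatest) auto
  moreover have "(\<lambda>k. indicator {p. \<forall>j\<in>{1..k}. p j \<noteq> x} p :: ennreal) = (\<lambda>k. if k < m then 1 else 0)"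
  proof
    fix k
    have "(\<forall>j\<in>{1..k}. p j \<noteq> x) \<longleftrightarrow> k < m"
      using m min by (metis atLeastAtMost_iff le_less_trans not_less)
    then show "(indicator {p. \<forall>j\<in>{1..k}. p j \<noteq> x} p :: ennreal) = (if k < m then 1 else 0)"
      by (simp add: indicator_def)
  qed
  moreover have "(\<Sum>k. if k < m then 1 else 0 :: ennreal) = (\<Sum>k<m. if k < m then 1 else 0)"
    by (rule suminf_finite) auto
  ultimately show ?thesis by simp
qed

section \<open>Chains driven by i.i.d. inputs, and their avoidance probabilities\<close>

locale random_map_chain =
  fixes I :: "'i pmf" and g :: "'x::countable \<Rightarrow> 'i \<Rightarrow> 'x"
    and X :: "'x \<Rightarrow> (nat \<Rightarrow> 'i) \<Rightarrow> nat \<Rightarrow> 'x"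
  assumes X_0 [simp]: "X x \<omega> 0 = x"
    and X_Suc: "X x \<omega> (Suc k) = g (X x \<omega> k) (\<omega> k)"
begin

sublocale sequence_space "measure_pmf I" ..

text \<open>Time 0 is not inspected, so for \<open>x = z\<close> this is the tail probability of the
  return time rather than 0.\<close>

definition avoid :: "'x \<Rightarrow> nat \<Rightarrow> 'x \<Rightarrow> real" where
  "avoid z k x = prob {\<omega> \<in> space S. \<forall>j\<in>{1..k}. X x \<omega> j \<noteq> z}"

text \<open>The Markov property at the level of paths: prepending the input \<open>i\<close> amounts
  to restarting from \<open>g x i\<close>.\<close>

lemma X_case_nat: "X x (case_nat i \<omega>) (Suc k) = X (g x i) \<omega> k"
  by (induction k) (auto simp: X_Suc)

lemma measurable_X [measurable]: "(\<lambda>\<omega>. X x \<omega> k) \<in> measurable S (count_space UNIV)"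
proof (induction k)
  case (Suc k)
  have "(\<lambda>\<omega>. g y (\<omega> k)) \<in> measurable S (count_space UNIV)" for y
    by (rule measurable_compose[of "\<lambda>\<omega>. \<omega> k" _ "measure_pmf I"]) auto
  from measurable_compose_countable[OF this Suc] show ?case by (simp add: X_Suc)
qed simp

lemma avoid_0: "avoid z 0 x = 1"
  by (simp add: avoid_def P.prob_space)

lemma avoid_nonneg: "0 \<le> avoid z k x"
  by (simp add: avoid_def)

lemma avoid_antimono: "k \<le> l \<Longrightarrow> avoid z l x \<le> avoid z k x"
  unfolding avoid_def by (rule finite_measure_mono) auto

text \<open>Prepending an independent input with law \<open>I\<close> to a sequence with law
  \<open>S\<close> gives the law \<open>S\<close> again (\<open>PiM_iter\<close>); Fubini does the
  rest.\<close>

lemma nn_integral_shift: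
  assumes [measurable]: "f \<in> borel_measurable S"
  shows "(\<integral>\<^sup>+\<omega>. f \<omega> \<partial>S) = (\<integral>\<^sup>+i. \<integral>\<^sup>+\<omega>. f (case_nat i \<omega>) \<partial>S \<partial>I)"
proof -
  have "(\<integral>\<^sup>+\<omega>. f \<omega> \<partial>S) = (\<integral>\<^sup>+\<omega>. f \<omega> \<partial>distr (measure_pmf I \<Otimes>\<^sub>M S) S (\<lambda>(s, \<omega>). case_nat s \<omega>))"
    by (simp add: PiM_iter)
  also have "\<dots> = (\<integral>\<^sup>+(i, \<omega>). f (case_nat i \<omega>) \<partial>(measure_pmf I \<Otimes>\<^sub>M S))"
    by (subst nn_integral_distr) (auto simp: case_prod_unfold)
  also have "\<dots> = (\<integral>\<^sup>+i. \<integral>\<^sup>+\<omega>. f (case_nat i \<omega>) \<partial>S \<partial>I)"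
    by (subst nn_integral_fst[symmetric]) auto
  finally show ?thesis .
qed

text \<open>First-step analysis: the first input is split off by \<open>nn_integral_shift\<close>,
  and \<open>X_case_nat\<close> restarts the remaining path from \<open>g x i\<close>.\<close>

lemma avoid_Suc:
  "ennreal (avoid z (Suc k) x) = (\<integral>\<^sup>+i. (if g x i = z then 0 else ennreal (avoid z k (g x i))) \<partial>I)"
proof -
  have ind: "indicator {\<omega> \<in> space S. \<forall>j\<in>{1..Suc k}. X x \<omega> j \<noteq> z} (case_nat i \<omega>)
      = (if g x i = z then 0 else indicator {\<omega> \<in> space S. \<forall>j\<in>{1..k}. X (g x i) \<omega> j \<noteq> z} \<omega> :: ennreal)"
    for i \<omega>
  proof -
    \<comment> \<open>All times become successors, as \<open>X_case_nat\<close> requires; the time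
      \<open>Suc 0\<close> yields the condition on \<open>g x i\<close>.\<close>
    have eq: "{1..Suc k} = Suc ` insert 0 {1..k}"
      by (auto simp: image_iff Suc_le_eq intro: gr0_implies_Suc)
    have "(\<forall>j\<in>{1..Suc k}. X x (case_nat i \<omega>) j \<noteq> z)
        \<longleftrightarrow> g x i \<noteq> z \<and> (\<forall>j\<in>{1..k}. X (g x i) \<omega> j \<noteq> z)"
      by (subst eq) (simp add: X_case_nat del: image_insert image_Suc_atLeastAtMost)
    then show ?thesis by (auto simp: indicator_def space_PiM)
  qed
  have "ennreal (avoid z (Suc k) x) = (\<integral>\<^sup>+\<omega>. indicator {\<omega> \<in> space S. \<forall>j\<in>{1..Suc k}. X x \<omega> j \<noteq> z} \<omega> \<partial>S)"
    by (simp add: avoid_def emeasure_eq_measure)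
  also have "\<dots> = (\<integral>\<^sup>+i. (if g x i = z then 0 else ennreal (avoid z k (g x i))) \<partial>I)"
    by (subst nn_integral_shift, simp, unfold ind, intro nn_integral_cong)
       (auto simp: avoid_def emeasure_eq_measure)
  finally show ?thesis .
qed

lemma nn_integral_return_time:
  "(\<integral>\<^sup>+\<omega>. return_time z (X x \<omega>) \<partial>S) = (\<Sum>k. ennreal (avoid z k x))"
proof -
  have "(\<integral>\<^sup>+\<omega>. return_time z (X x \<omega>) \<partial>S)
      = (\<integral>\<^sup>+\<omega>. (\<Sum>k. indicator {\<omega> \<in> space S. \<forall>j\<in>{1..k}. X x \<omega> j \<noteq> z} \<omega>) \<partial>S)"
    by (intro nn_integral_cong) (auto simp: return_time_eq_suminf indicator_def)
  also have "\<dots> = (\<Sum>k. \<integral>\<^sup>+\<omega>. indicator {\<omega> \<in> space S. \<forall>j\<in>{1..k}. X x \<omega> j \<noteq> z} \<omega> \<partial>S)"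
    by (rule nn_integral_suminf) measurable
  also have "\<dots> = (\<Sum>k. ennreal (avoid z k x))"
    by (simp add: avoid_def emeasure_eq_measure)
  finally show ?thesis .
qed

section \<open>Consequences of irreducibility\<close>

lemma irreducible_on_closed:
  assumes "irreducible_on S X E" "x \<in> E" "i \<in> set_pmf I"
  shows "g x i \<in> E"
proof -
  have "AE \<omega> in S. X x \<omega> (Suc 0) \<in> E"
    using assms(1,2) unfolding irreducible_on_def by blast
  then have "AE \<omega> in S. g x (\<omega> 0) \<in> E" by (simp add: X_Suc)
  \<comment> \<open>The state at time 1 depends on the first input only, whose law is the discrete
    \<open>I\<close>; there an almost sure statement holds on the whole support.\<close>
  then have "AE i in distr S (measure_pmf I) (\<lambda>\<omega>. \<omega> 0). g x i \<in> E"
    by (subst AE_distr_iff) auto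
  then have "AE i in measure_pmf I. g x i \<in> E"
    by (subst (asm) PiM_component) auto
  then show ?thesis using assms(3) by (simp add: AE_measure_pmf_iff)
qed

text \<open>Some time \<open>k\<close> has a positive probability of being at \<open>z\<close>, and
  \<open>k \<noteq> 0\<close> since \<open>x \<noteq> z\<close>, so this visit falls into
  \<open>1..k\<close>.\<close>

lemma irreducible_on_avoid_less_1:
  assumes "irreducible_on S X E" "x \<in> E" "z \<in> E" "x \<noteq> z"
  shows "\<exists>k. avoid z k x < 1"
proof -
  obtain k where k: "prob {\<omega> \<in> space S. X x \<omega> k = z} > 0"
    using assms unfolding irreducible_on_def by blast
  have "k \<noteq> 0" using k assms(4) by (cases k) auto
  then have "{\<omega> \<in> space S. \<forall>j\<in>{1..k}. X x \<omega> j \<noteq> z} \<subseteq> space S - {\<omega> \<in> space S. X x \<omega> k = z}"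
    by auto
  then have "avoid z k x \<le> prob (space S - {\<omega> \<in> space S. X x \<omega> k = z})"
    unfolding avoid_def by (rule finite_measure_mono) measurable
  also have "\<dots> = 1 - prob {\<omega> \<in> space S. X x \<omega> k = z}"
    by (rule prob_compl) measurable
  finally show ?thesis using k by (intro exI[of _ k]) auto
qed

text \<open>Almost surely \<open>h\<close> does not decrease along the path, and \<open>y\<close> is
  reached from \<open>x\<close> with positive probability, so some path witnesses the
  inequality.\<close>

lemma irreducible_on_mono:
  fixes h :: "'x \<Rightarrow> 'b::order"
  assumes irr: "irreducible_on S X E" and x: "x \<in> E" and y: "y \<in> E"
    and mono: "\<And>x i. i \<in> set_pmf I \<Longrightarrow> h x \<le> h (g x i)"
  shows "h x \<le> h y"
proof -
  obtain k where k: "prob {\<omega> \<in> space S. X x \<omega> k = y} > 0"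
    using irr x y unfolding irreducible_on_def by blast
  have "AE \<omega> in S. \<forall>j. \<omega> j \<in> set_pmf I"
    unfolding AE_all_countable
    by (intro allI AE_component AE_pmfI) auto
  then have "AE \<omega> in S. h x \<le> h (X x \<omega> k)"
  proof eventually_elim
    case (elim \<omega>)
    show ?case
    proof (induction k)
      case (Suc k)
      with mono[of "\<omega> k" "X x \<omega> k"] elim show ?case by (simp add: X_Suc)
    qed simp
  qed
  moreover have "\<not> (AE \<omega> in S. X x \<omega> k \<noteq> y)"
    using k P.prob_eq_0[of "{\<omega> \<in> space S. X x \<omega> k = y}"] by auto
  then have "\<not> (AE \<omega> in S. \<not> X x \<omega> k = y)" by simp
  ultimately obtain \<omega> where "h x \<le> h (X x \<omega> k)" "X x \<omega> k = y"
    using eventually_mono[of "\<lambda>\<omega>. h x \<le> h (X x \<omega> k)" "ae_filter S" "\<lambda>\<omega>. X x \<omega> k \<noteq> y"] by blast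
  then show ?thesis by simp
qed

section \<open>Partial sums of avoidance probabilities and supersolutions\<close>

lemma sum_avoid_step:
  "(\<integral>\<^sup>+i. (if g x i = z then 0 else (\<Sum>m<k. ennreal (avoid z m (g x i)))) \<partial>I) + 1
     = (\<Sum>m<Suc k. ennreal (avoid z m x))"
proof -
  have "(\<integral>\<^sup>+i. (if g x i = z then 0 else (\<Sum>m<k. ennreal (avoid z m (g x i)))) \<partial>I)
      = (\<integral>\<^sup>+i. (\<Sum>m<k. if g x i = z then 0 else ennreal (avoid z m (g x i))) \<partial>I)"
    by (intro nn_integral_cong) auto
  also have "\<dots> = (\<Sum>m<k. ennreal (avoid z (Suc m) x))"
    by (subst nn_integral_sum) (auto simp: avoid_Suc)
  finally show ?thesis
    unfolding sum.lessThan_Suc_shift by (simp add: avoid_0 add.commute)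
qed

text \<open>Induction with first-step analysis: away from \<open>z\<close> the supersolution
  \<open>W\<close> dominates the partial sums. The bound is phrased by one step from
  \<open>x\<close> instead of \<open>W x\<close>, so that it also covers \<open>x = z\<close>, where
  \<open>step\<close> says nothing.\<close>

lemma sum_avoid_le:
  assumes closed: "\<And>x i. x \<in> E \<Longrightarrow> i \<in> set_pmf I \<Longrightarrow> g x i \<in> E"
    and step: "\<And>x. x \<in> E \<Longrightarrow> x \<noteq> z \<Longrightarrow> (\<integral>\<^sup>+i. (if g x i = z then 0 else W (g x i)) \<partial>I) + 1 \<le> W x"
    and x: "x \<in> E"
  shows "(\<Sum>m<Suc k. ennreal (avoid z m x)) \<le> (\<integral>\<^sup>+i. (if g x i = z then 0 else W (g x i)) \<partial>I) + 1"
  using x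
proof (induction k arbitrary: x)
  case (Suc k)
  have "(\<Sum>m<Suc k. ennreal (avoid z m y)) \<le> W y" if "y \<in> E" "y \<noteq> z" for y
    using Suc.IH[OF that(1)] step[OF that] by (rule order_trans)
  then have "AE i in I. (if g x i = z then 0 else \<Sum>m<Suc k. ennreal (avoid z m (g x i)))
               \<le> (if g x i = z then 0 else W (g x i))"
    using closed[OF Suc.prems] by (auto simp: AE_measure_pmf_iff simp del: sum.lessThan_Suc)
  then show ?case
    unfolding sum_avoid_step[symmetric, of _ _ "Suc k"]
    by (intro add_right_mono nn_integral_mono_AE)
qed (simp add: avoid_0)

text \<open>The partial sums \<open>U = (\<Sum>m<N. avoid z m)\<close> have drift \<open>avoid z N - 1\<close> away from \<open>z\<close>, which is
  uniformly negative on a finite set; a multiple of \<open>U\<close> makes up for the defect of \<open>V\<close> there.\<close>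

theorem foster_positive_recurrent:
  assumes irr: "irreducible_on S X E"
    and fin: "finite (B \<inter> E)" and b: "0 \<le> b"
    and V: "\<And>x. V x < \<infinity>"
    and drift: "\<And>x. x \<in> E \<Longrightarrow> (\<integral>\<^sup>+i. V (g x i) \<partial>I) + 1 \<le> V x + ennreal b * indicator B x"
  shows "positive_recurrent_on S X E"
  unfolding positive_recurrent_on_def
proof
  fix z assume z: "z \<in> E"
  note closed = irreducible_on_closed[OF irr]
  let ?F = "B \<inter> E - {z}"
  have "\<forall>x\<in>?F. \<exists>k. avoid z k x < 1"
    using irreducible_on_avoid_less_1[OF irr _ z] by auto
  then obtain t where t: "\<And>x. x \<in> ?F \<Longrightarrow> avoid z (t x) x < 1" by metis
  \<comment> \<open>A common upper bound of all \<open>t x\<close> on the finite set;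
    \<open>avoid\<close> is antitone in the time.\<close>
  define N where "N = sum t ?F"
  have N: "avoid z N x < 1" if "x \<in> ?F" for x
  proof -
    have "t x \<le> N" unfolding N_def using that fin by (intro member_le_sum) auto
    then show ?thesis using avoid_antimono t[OF that] by (meson le_less_trans)
  qed
  have nonneg: "0 \<le> b / (1 - avoid z N x)" if "x \<in> ?F" for x
    using N[OF that] b by simp
  \<comment> \<open>Each summand is the constant that its own \<open>x\<close> requires:
    \<open>b / (1 - avoid z N x) \<le> c\<close> rearranges to
    \<open>b + c * avoid z N x \<le> c\<close>.\<close>
  define c where "c = (\<Sum>x\<in>?F. b / (1 - avoid z N x))"
  have c0: "0 \<le> c" unfolding c_def by (intro sum_nonneg nonneg)
  have c: "b + c * avoid z N x \<le> c" if "x \<in> ?F" for x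
  proof -
    have "b / (1 - avoid z N x) \<le> c" unfolding c_def using that fin
      by (intro member_le_sum nonneg) auto
    then show ?thesis using N[OF that] by (simp add: field_simps)
  qed
  define U where "U x = (\<Sum>m<N. ennreal (avoid z m x))" for x
  define W where "W x = V x + ennreal c * U x" for x
  let ?P = "\<lambda>f x. \<integral>\<^sup>+i. (if g x i = z then 0 else f (g x i)) \<partial>I"
  have PW: "?P W x = ?P V x + ennreal c * ?P U x" for x
  proof -
    have "?P W x = (\<integral>\<^sup>+i. (if g x i = z then 0 else V (g x i))
        + ennreal c * (if g x i = z then 0 else U (g x i)) \<partial>I)"
      by (intro nn_integral_cong) (auto simp: W_def)
    then show ?thesis by (simp add: nn_integral_add nn_integral_cmult)
  qed
  have PV: "?P V x + 1 \<le> V x + ennreal b * indicator B x" if "x \<in> E" for x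
    by (rule order_trans[OF add_right_mono drift[OF that]]) (auto intro!: nn_integral_mono)
  have PU: "?P U x + 1 = U x + ennreal (avoid z N x)" for x
    unfolding U_def sum_avoid_step by simp
  have step: "?P W x + 1 \<le> W x" if x: "x \<in> E" "x \<noteq> z" for x
  proof -
    have *: "ennreal b * indicator B x + ennreal c * ennreal (avoid z N x) \<le> ennreal c"
    proof (cases "x \<in> B")
      case True
      then have "ennreal (b + c * avoid z N x) \<le> ennreal c" using c[of x] x by (intro ennreal_leI) auto
      then show ?thesis using True b c0 by (simp add: ennreal_mult avoid_nonneg)
    next
      case False
      have "c * avoid z N x \<le> c * 1"
        using c0 avoid_antimono[of 0 N z x] by (intro mult_left_mono) (auto simp: avoid_0)
      then show ?thesis using False c0
        by (simp add: avoid_nonneg ennreal_leI flip: ennreal_mult)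
    qed
    \<comment> \<open>The finite \<open>ennreal c\<close> is added to both sides in place of a
      subtraction in \<open>ennreal\<close>, and cancelled at the end.\<close>
    have "?P W x + 1 + ennreal c = (?P V x + 1) + ennreal c * (?P U x + 1)"
      by (simp add: PW algebra_simps)
    also have "\<dots> \<le> (V x + ennreal b * indicator B x) + ennreal c * (U x + ennreal (avoid z N x))"
      unfolding PU by (intro add_right_mono PV x)
    also have "\<dots> = W x + (ennreal b * indicator B x + ennreal c * ennreal (avoid z N x))"
      by (simp add: W_def algebra_simps)
    also have "\<dots> \<le> W x + ennreal c" by (intro add_left_mono *)
    finally show ?thesis by (simp add: ennreal_add_left_cancel_le add.commute[of _ "ennreal c"])
  qed
  have U_fin: "U x < \<infinity>" for x by (simp add: U_def)
  \<comment> \<open>At \<open>z\<close> itself it suffices that the expectation after one step is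
    finite, which follows from \<open>drift\<close> for \<open>V\<close> and from \<open>PU\<close>
    for \<open>U\<close>.\<close>
  have "?P V z < \<infinity>"
  proof -
    have "?P V z \<le> ?P V z + 1" by simp
    also note PV[OF z]
    also have "V z + ennreal b * indicator B z < \<infinity>" using V[of z] by (simp add: ennreal_mult_less_top indicator_def)
    finally show ?thesis .
  qed
  moreover have "?P U z < \<infinity>"
  proof -
    have "?P U z \<le> ?P U z + 1" by simp
    also note PU
    also have "U z + ennreal (avoid z N z) < \<infinity>" using U_fin[of z] by simp
    finally show ?thesis .
  qed
  ultimately have fin_z: "?P W z + 1 < \<infinity>" by (simp add: PW ennreal_mult_less_top)
  have "(\<Sum>m<n. ennreal (avoid z m z)) \<le> ?P W z + 1" for n
    using sum_avoid_le[of E z W, OF closed step z, of n]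
    by (intro order_trans[OF sum_mono2[of "{..<Suc n}" "{..<n}"]]) auto
  then have "(\<Sum>m. ennreal (avoid z m z)) \<le> ?P W z + 1"
    unfolding suminf_eq_SUP by (rule SUP_least)
  then show "(\<integral>\<^sup>+ \<omega>. return_time z (X z \<omega>) \<partial>S) < \<infinity>"
    using fin_z by (simp add: nn_integral_return_time order_le_less_trans)
qed

end

subsection \<open>Routing to the shortest queue of a random set\<close>

lemma sum_list_take_sorted_le:
  fixes xs :: "'a::{linorder, ordered_comm_monoid_add} list"
  assumes "sorted xs" "N \<subseteq># mset xs"
  shows "sum_list (take (size N) xs) \<le> sum_mset N"
  using assms
proof (induction xs arbitrary: N)
  case (Cons x xs)
  show ?case
  proof (cases "N = {#}")
    case False
    \<comment> \<open>Exchange argument: the least entry \<open>x\<close> is matched with an element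
      \<open>y\<close> of \<open>N\<close>, with \<open>x\<close> itself if it occurs and with any
      element otherwise, so that the rest of \<open>N\<close> fits into the tail.\<close>
    obtain y N' where N: "N = add_mset y N'" "x \<le> y" "N' \<subseteq># mset xs"
    proof (cases "x \<in># N")
      case True
      then obtain N' where "N = add_mset x N'" by (meson mset_add)
      with Cons.prems show thesis by (intro that[of x N']) auto
    next
      case no: False
      from False obtain y N' where y: "N = add_mset y N'" by (meson multiset_nonemptyE mset_add)
      from no Cons.prems have sub: "N \<subseteq># mset xs"
        by (simp add: inter_add_right1 subset_mset.inf.absorb_iff1)
      then have "y \<in> set xs" using mset_subset_eqD[of N "mset xs" y] y by simp
      moreover have "N' \<subseteq># mset xs" using sub unfolding y by (meson mset_subset_eq_insertD subset_mset.less_imp_le)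
      ultimately show thesis using Cons.prems y by (intro that[of y N']) auto
    qed
    then show ?thesis using Cons.IH[of N'] Cons.prems by (auto intro: add_mono)
  qed simp
qed simp

lemma sum_ith_smallest_le:
  fixes \<mu> :: "real ^ 'n"
  shows "(\<Sum>i=1..card A. ith_smallest \<mu> i) \<le> (\<Sum>i\<in>A. \<mu> $ i)"
proof -
  define xs where "xs = sorted_list_of_multiset (image_mset (\<lambda>j. \<mu> $ j) (mset_set UNIV))"
  define N where "N = image_mset (\<lambda>j. \<mu> $ j) (mset_set A)"
  have size: "size N = card A" by (simp add: N_def)
  have sub: "N \<subseteq># mset xs"
    unfolding N_def xs_def by (simp add: image_mset_subseteq_mono subset_imp_msubset_mset_set)
  have "card A \<le> length xs" using size_mset_mono[OF sub] by (simp add: size)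
  have "(\<Sum>i=1..card A. ith_smallest \<mu> i) = (\<Sum>i<card A. xs ! i)"
    by (rule sum.reindex_bij_witness[of _ Suc "\<lambda>i. i - 1"]) (auto simp: ith_smallest_def xs_def)
  also have "\<dots> = sum_list (take (size N) xs)"
    using \<open>card A \<le> length xs\<close> by (simp add: sum_list_sum_nth size atLeast0LessThan)
  also have "\<dots> \<le> sum_mset N"
    by (rule sum_list_take_sorted_le[OF _ sub]) (simp add: xs_def)
  also have "\<dots> = (\<Sum>i\<in>A. \<mu> $ i)" by (simp add: N_def sum_unfold_sum_mset)
  finally show ?thesis .
qed

text \<open>With \<open>A\<close> enumerated last, a nonempty subset of \<open>A\<close> is first
  met at one of the last \<open>card A\<close> positions, which are the ones that
  \<open>S_tau \<tau> i\<close> with \<open>i \<le> card A\<close> refers to.\<close>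

lemma exists_enumeration_ending_in:
  fixes A :: "'n::finite set"
  obtains \<tau> where "bij_betw \<tau> {1..CARD('n)} UNIV" "\<tau> ` {1..CARD('n) - card A} = - A"
proof -
  let ?n = "CARD('n)" and ?j = "card A"
  have j: "?j \<le> ?n" by (rule card_mono) auto
  have "card {1..?n - ?j} = card (- A)" by (simp add: Compl_eq_Diff_UNIV card_Diff_subset)
  then obtain f where f: "bij_betw f {1..?n - ?j} (- A)"
    using finite_same_card_bij by (metis finite finite_atLeastAtMost)
  have "card {?n - ?j + 1..?n} = card A" using j by simp
  then obtain h where h: "bij_betw h {?n - ?j + 1..?n} A"
    using finite_same_card_bij by (metis finite finite_atLeastAtMost)
  define \<tau> where "\<tau> i = (if i \<le> ?n - ?j then f i else h i)" for i
  have 1: "bij_betw \<tau> {1..?n - ?j} (- A)"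
    using f by (rule bij_betw_cong[THEN iffD1, rotated]) (auto simp: \<tau>_def)
  have 2: "bij_betw \<tau> {?n - ?j + 1..?n} A"
    using h by (rule bij_betw_cong[THEN iffD1, rotated]) (auto simp: \<tau>_def)
  have "{1..?n - ?j} \<union> {?n - ?j + 1..?n} = {1..?n}" by auto
  with bij_betw_combine[OF 1 2] have "bij_betw \<tau> {1..?n} UNIV" by simp
  then show thesis using 1 by (intro that) (auto simp: bij_betw_def)
qed

text \<open>The nonempty subsets of \<open>A\<close> are covered by \<open>S_tau \<tau> i\<close>,
  \<open>i \<le> card A\<close>, for an enumeration ending in \<open>A\<close>; the union bound and
  \<open>M_tau\<close> at \<open>j = card A\<close> give the claim. As \<open>M_tau\<close> only
  treats \<open>1 \<le> j < CARD('n)\<close>, the empty and the full set are handled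
  directly.\<close>

lemma prob_subset_le:
  fixes \<pi> :: "'n::finite set pmf"
  assumes M: "\<And>\<tau>. bij_betw \<tau> {1..CARD('n)} (UNIV :: 'n set) \<Longrightarrow> \<mu> \<in> M_tau \<pi> \<tau>"
    and pos: "total_rate \<mu> > 0" and empty: "pmf \<pi> {} = 0"
  shows "measure_pmf.prob \<pi> {S. S \<subseteq> A} * total_rate \<mu> \<le> (\<Sum>i\<in>A. \<mu> $ i)"
proof -
  let ?n = "CARD('n)" and ?j = "card A"
  consider "A = {}" | "A = UNIV" | "?j \<in> {1..?n - 1}"
  proof -
    have "?j < ?n" if "A \<noteq> UNIV" using that by (intro psubset_card_mono) auto
    moreover have "1 \<le> ?j" if "A \<noteq> {}" using that by (simp add: Suc_le_eq card_gt_0_iff)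
    ultimately show ?thesis using that by fastforce
  qed
  then show ?thesis
  proof cases
    case 1
    have "{S. S \<subseteq> A} = {{}}" using 1 by auto
    then show ?thesis using empty 1 by (simp add: measure_pmf_single)
  next
    case 2
    then show ?thesis by (simp add: total_rate_def)
  next
    case 3
    obtain \<tau> where \<tau>: "bij_betw \<tau> {1..?n} UNIV" "\<tau> ` {1..?n - ?j} = - A"
      by (rule exists_enumeration_ending_in)
    have cover: "{S. S \<subseteq> A} - {{}} \<subseteq> (\<Union>i\<in>{1..?j}. S_tau \<tau> i)"
    proof
      fix S assume S: "S \<in> {S. S \<subseteq> A} - {{}}"
      define l where "l = (LEAST l. l \<in> {1..?n} \<and> \<tau> l \<in> S)"
      obtain s where "s \<in> S" using S by auto
      then have "\<exists>l. l \<in> {1..?n} \<and> \<tau> l \<in> S" using \<tau>(1) by (metis UNIV_I bij_betw_def imageE)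
      then have l: "l \<in> {1..?n}" "\<tau> l \<in> S" unfolding l_def by (metis (mono_tags, lifting) LeastI)+
      have min: "\<tau> m \<notin> S" if "m \<in> {1..<l}" for m
        using that l(1) not_less_Least[of m "\<lambda>l. l \<in> {1..?n} \<and> \<tau> l \<in> S", folded l_def] by auto
      have "\<tau> l \<in> A" using S l by auto
      then have "l \<notin> {1..?n - ?j}" using \<tau>(2) by blast
      \<comment> \<open>\<open>S_tau\<close> counts positions from the end, so first meeting
        \<open>S\<close> at position \<open>l\<close> corresponds to the index
        \<open>?n - l + 1\<close>.\<close>
      then have "?n - l + 1 \<in> {1..?j}" "?n - (?n - l + 1) + 1 = l" using l(1) 3 by auto
      moreover from this have "S \<in> S_tau \<tau> (?n - l + 1)"
        unfolding S_tau_def using l(2) min by simp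
      ultimately show "S \<in> (\<Union>i\<in>{1..?j}. S_tau \<tau> i)" by blast
    qed
    have "measure_pmf.prob \<pi> {S. S \<subseteq> A} = measure_pmf.prob \<pi> ({S. S \<subseteq> A} - {{}})"
      using empty by (intro measure_pmf.finite_measure_eq_AE) (auto simp: AE_measure_pmf_iff set_pmf_iff)
    also have "\<dots> \<le> measure_pmf.prob \<pi> (\<Union>i\<in>{1..?j}. S_tau \<tau> i)"
      by (rule measure_pmf.finite_measure_mono[OF cover]) simp
    also have "\<dots> \<le> (\<Sum>i=1..?j. measure_pmf.prob \<pi> (S_tau \<tau> i))"
      by (rule measure_pmf.finite_measure_subadditive_finite) auto
    also have "\<dots> = (\<Sum>i=1..?j. \<Sum>S\<in>S_tau \<tau> i. pmf \<pi> S)"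
      by (simp add: measure_measure_pmf_finite)
    also have "\<dots> \<le> (\<Sum>i=1..?j. ith_smallest \<mu> i) / total_rate \<mu>"
      using M[OF \<tau>(1)] 3 unfolding M_tau_def by blast
    finally have "measure_pmf.prob \<pi> {S. S \<subseteq> A} * total_rate \<mu> \<le> (\<Sum>i=1..?j. ith_smallest \<mu> i)"
      using pos by (simp add: field_simps)
    also note sum_ith_smallest_le
    finally show ?thesis .
  qed
qed

section \<open>The server chosen by the routing\<close>

lemma shortest_nonempty: "S \<noteq> {} \<Longrightarrow> shortest q S \<noteq> {}"
  using ex_is_arg_min_if_finite[of S "\<lambda>i. q $ i"] 
  by (auto simp: shortest_def is_arg_min_linorder)

lemma tie_break_mem:
  assumes "c \<in> set_pmf tie_break" "T \<noteq> {}"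
  shows "c T \<in> T"
proof -
  have "c T \<in> set_pmf (map_pmf (\<lambda>c. c T) tie_break)" using assms(1) by simp
  then show ?thesis using assms(2) by (simp add: tie_break_uniform)
qed

lemma R_route_le:
  assumes "(S, c) \<in> set_pmf (R_rnd \<pi>)" "pmf \<pi> {} = 0" "j \<in> S"
  shows "q $ R_route q (S, c) \<le> q $ j"
proof -
  have "c (shortest q S) \<in> shortest q S"
    using assms shortest_nonempty[of S q] by (intro tie_break_mem[of c]) (auto simp: R_rnd_def)
  then show ?thesis using assms(3) by (auto simp: R_route_def shortest_def)
qed

text \<open>Both sides are sums over the levels \<open>t\<close>: the queue joined is longer than \<open>t\<close> iff all servers of the
  selected set have queues longer than \<open>t\<close>.\<close>

lemma expected_route_le:
  fixes \<pi> :: "'n::finite set pmf"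
  assumes subset: "\<And>A. measure_pmf.prob \<pi> {S. S \<subseteq> A} * T \<le> (\<Sum>i\<in>A. \<mu> $ i)"
    and T: "0 \<le> T" and empty: "pmf \<pi> {} = 0"
  shows "ennreal T * (\<integral>\<^sup>+r. of_nat (q $ R_route q r) \<partial>R_rnd \<pi>) \<le> ennreal (\<Sum>i\<in>UNIV. \<mu> $ i * real (q $ i))"
proof -
  \<comment> \<open>A common bound of the queue lengths, which makes the number of levels
    finite.\<close>
  define N where "N = (\<Sum>i\<in>UNIV. q $ i)"
  have level: "m = (\<Sum>t<N. of_bool (t < m))" if "m \<le> N" for m
  proof -
    have "{..<N} \<inter> {t. t < m} = {..<m}" using that by auto
    then show ?thesis by (simp add: of_bool_def sum.If_cases)
  qed
  have le_N: "q $ i \<le> N" for i unfolding N_def by (rule member_le_sum) auto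
  have "(\<integral>\<^sup>+r. of_nat (q $ R_route q r) \<partial>R_rnd \<pi>)
      = (\<integral>\<^sup>+r. (\<Sum>t<N. of_bool (t < q $ R_route q r)) \<partial>R_rnd \<pi>)"
    by (intro nn_integral_cong, subst level[OF le_N]) (simp add: of_nat_of_bool)
  also have "\<dots> \<le> (\<integral>\<^sup>+r. (\<Sum>t<N. indicator {S. S \<subseteq> {i. t < q $ i}} (fst r)) \<partial>R_rnd \<pi>)"
  proof (intro nn_integral_mono_AE, unfold AE_measure_pmf_iff, intro ballI sum_mono)
    fix r t assume r: "r \<in> set_pmf (R_rnd \<pi>)"
    obtain S c where [simp]: "r = (S, c)" by fastforce
    have "t < q $ j" if "t < q $ R_route q r" "j \<in> S" for j
      using that r R_route_le[OF _ empty, of S c j q] by simp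
    then show "of_bool (t < q $ R_route q r)
        \<le> (indicator {S. S \<subseteq> {i. t < q $ i}} (fst r) :: ennreal)"
      by (auto simp: indicator_def)
  qed
  also have "\<dots> = (\<Sum>t<N. \<integral>\<^sup>+S. indicator {S. S \<subseteq> {i. t < q $ i}} S \<partial>map_pmf fst (R_rnd \<pi>))"
    by (simp add: nn_integral_sum)
  also have "\<dots> = (\<Sum>t<N. ennreal (measure_pmf.prob \<pi> {S. S \<subseteq> {i. t < q $ i}}))"
    by (simp add: R_rnd_def map_fst_pair_pmf measure_pmf.emeasure_eq_measure)
  finally have "ennreal T * (\<integral>\<^sup>+r. of_nat (q $ R_route q r) \<partial>R_rnd \<pi>)
      \<le> ennreal T * (\<Sum>t<N. ennreal (measure_pmf.prob \<pi> {S. S \<subseteq> {i. t < q $ i}}))"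
    by (rule mult_left_mono) simp
  also have "\<dots> = ennreal (\<Sum>t<N. measure_pmf.prob \<pi> {S. S \<subseteq> {i. t < q $ i}} * T)"
    using T by (simp add: sum_nonneg sum_distrib_left mult.commute flip: ennreal_mult)
  \<comment> \<open>The hypothesis on subsets, applied to each level set
    \<open>{i. t < q $ i}\<close>.\<close>
  also have "\<dots> \<le> ennreal (\<Sum>t<N. \<Sum>i | t < q $ i. \<mu> $ i)"
    by (intro ennreal_leI sum_mono subset)
  also have "(\<Sum>t<N. \<Sum>i | t < q $ i. \<mu> $ i) = (\<Sum>i\<in>UNIV. \<mu> $ i * real (q $ i))"
  proof -
    have "(\<Sum>t<N. \<Sum>i | t < q $ i. \<mu> $ i) = (\<Sum>t<N. \<Sum>i\<in>UNIV. \<mu> $ i * of_bool (t < q $ i))"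
      by (intro sum.cong refl sum.mono_neutral_cong_left) auto
    also have "\<dots> = (\<Sum>i\<in>UNIV. \<mu> $ i * (\<Sum>t<N. of_bool (t < q $ i)))"
      by (subst sum.swap) (simp add: sum_distrib_left mult.commute)
    also have "\<dots> = (\<Sum>i\<in>UNIV. \<mu> $ i * real (\<Sum>t<N. of_bool (t < q $ i)))"
      by (simp add: of_nat_of_bool)
    finally show ?thesis by (simp flip: level[OF le_N])
  qed
  finally show ?thesis .
qed

subsection \<open>Quadratic drift\<close>

definition queue_step :: "nat ^ 'n::finite \<Rightarrow> nat \<times> (nat ^ 'n) \<times> ('n set \<times> ('n set \<Rightarrow> 'n)) \<Rightarrow> nat ^ 'n" where
  "queue_step q = (\<lambda>(a, s, r). next_queue q (routed (R_route q r) a) s)"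

definition sq_norm :: "nat ^ 'n::finite \<Rightarrow> nat" where
  "sq_norm q = (\<Sum>i\<in>UNIV. (q $ i)\<^sup>2)"

lemma next_queue_nth: "next_queue q a s $ i = (q $ i + a $ i) - s $ i"
  by (simp add: next_queue_def unused_service_def)

text \<open>Expanding the square coordinatewise; the service term stands on the left so that
  everything stays in \<open>nat\<close>. If service exceeds the available jobs, the new square is 0
  and \<open>2 * x * y \<le> x\<^sup>2 + y\<^sup>2\<close> takes over.\<close>

lemma sq_norm_next_queue_le:
  "sq_norm (next_queue q (routed i a) s) + 2 * (\<Sum>i\<in>UNIV. q $ i * s $ i)
     \<le> sq_norm q + 2 * a * q $ i + a\<^sup>2 + sq_norm s"
proof -
  have *: "(x + b - y)\<^sup>2 + 2 * (x * y) \<le> (x + b)\<^sup>2 + y\<^sup>2" for x b y :: nat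
  proof (cases "y \<le> x + b")
    case True
    then obtain d where d: "x + b = y + d" using le_Suc_ex by blast
    have "d\<^sup>2 + 2 * (x * y) \<le> d\<^sup>2 + 2 * ((y + d) * y)"
      by (simp flip: d)
    also have "\<dots> = (y + d)\<^sup>2 + y\<^sup>2" by (simp add: power2_eq_square algebra_simps)
    finally show ?thesis by (simp add: d)
  next
    case False
    have "real (2 * (x * y)) \<le> real (x\<^sup>2 + y\<^sup>2)"
      using sum_squares_bound[of "real x" "real y"] by simp
    then have "2 * (x * y) \<le> x\<^sup>2 + y\<^sup>2"
      unfolding of_nat_le_iff .
    also have "\<dots> \<le> (x + b)\<^sup>2 + y\<^sup>2" by simp
    finally show ?thesis using False by simp
  qed
  have "sq_norm (next_queue q (routed i a) s) + 2 * (\<Sum>j\<in>UNIV. q $ j * s $ j)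
      = (\<Sum>j\<in>UNIV. (q $ j + routed i a $ j - s $ j)\<^sup>2 + 2 * (q $ j * s $ j))"
    by (simp add: sq_norm_def next_queue_nth sum.distrib sum_distrib_left)
  also have "\<dots> \<le> (\<Sum>j\<in>UNIV. (q $ j + routed i a $ j)\<^sup>2 + (s $ j)\<^sup>2)"
    by (intro sum_mono *)
  also have "\<dots> = (\<Sum>j\<in>UNIV. (q $ j)\<^sup>2 + (if j = i then 2 * a * q $ j + a\<^sup>2 else 0) + (s $ j)\<^sup>2)"
    by (intro sum.cong) (auto simp: routed_def power2_sum)
  also have "\<dots> = sq_norm q + 2 * a * q $ i + a\<^sup>2 + sq_norm s"
    by (simp add: sum.distrib sq_norm_def)
  finally show ?thesis .
qed

section \<open>Moments and the expected one-step change\<close>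

lemma nn_integral_of_nat_pmf:
  assumes "integrable (measure_pmf p) (\<lambda>x. real (f x))"
  shows "(\<integral>\<^sup>+x. of_nat (f x) \<partial>p) = ennreal (measure_pmf.expectation p (\<lambda>x. real (f x)))"
  using assms by (simp add: ennreal_of_nat_eq_real_of_nat nn_integral_eq_integral)

lemma integrable_of_square_pmf:
  assumes "integrable (measure_pmf p) (\<lambda>x. (real (f x))\<^sup>2)"
  shows "integrable (measure_pmf p) (\<lambda>x. real (f x))"
  using measure_pmf.square_integrable_imp_integrable[OF _ assms] by simp

text \<open>The pointwise bound \<open>sq_norm_next_queue_le\<close> is integrated. The term
  \<open>a * q $ R_route q r\<close> factorizes because arrivals and routing randomness are
  independent.\<close>

lemma queue_step_drift:
  fixes serv :: "(nat ^ 'n::finite) pmf"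
  shows "(\<integral>\<^sup>+i. of_nat (sq_norm (queue_step q i)) \<partial>pair_pmf arr (pair_pmf serv rnd))
      + (\<integral>\<^sup>+s. of_nat (2 * (\<Sum>i\<in>UNIV. q $ i * s $ i)) \<partial>serv)
    \<le> of_nat (sq_norm q) + 2 * (\<integral>\<^sup>+a. of_nat a \<partial>arr) * (\<integral>\<^sup>+r. of_nat (q $ R_route q r) \<partial>rnd)
      + ((\<integral>\<^sup>+a. of_nat (a\<^sup>2) \<partial>arr) + (\<integral>\<^sup>+s. of_nat (sq_norm s) \<partial>serv))"
    (is "?L \<le> ?R")
proof -
  let ?J = "pair_pmf arr (pair_pmf serv rnd)"
  have "?L = (\<integral>\<^sup>+(a, s, r). of_nat (sq_norm (next_queue q (routed (R_route q r) a) s)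
      + 2 * (\<Sum>i\<in>UNIV. q $ i * s $ i)) \<partial>?J)"
    by (simp add: queue_step_def nn_integral_pair_pmf' nn_integral_add del: of_nat_sum of_nat_mult)
  also have "\<dots> \<le> (\<integral>\<^sup>+(a, s, r). of_nat (sq_norm q + 2 * a * q $ R_route q r + a\<^sup>2 + sq_norm s) \<partial>?J)"
    by (intro nn_integral_mono) (auto simp del: of_nat_add simp: sq_norm_next_queue_le)
  also have "\<dots> = ?R"
    by (simp add: nn_integral_pair_pmf' nn_integral_add nn_integral_cmult nn_integral_multc
        mult.assoc add.assoc)
  finally show ?thesis .
qed

lemma finite_vec_bounded:
  fixes b :: "'n::finite \<Rightarrow> nat"
  shows "finite {q :: nat ^ 'n. \<forall>i. q $ i \<le> b i}"
proof -
  have "{q :: nat ^ 'n. \<forall>i. q $ i \<le> b i} \<subseteq> vec_lambda ` (\<Pi>\<^sub>E i\<in>UNIV. {..b i})"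
    by (auto intro!: image_eqI[of _ _ "vec_nth _"])
  then show ?thesis by (rule finite_subset) (intro finite_imageI finite_PiE, auto)
qed

section \<open>Negative drift outside a finite set, and positive recurrence\<close>

theorem theorem7:
  fixes \<pi> :: "'n::finite set pmf"
    and serv :: "(nat ^ 'n) pmf"
    and arr :: "real \<Rightarrow> nat pmf"
    and E :: "real \<Rightarrow> (nat ^ 'n) set"
    and \<mu> :: "real ^ 'n"
  assumes "pmf \<pi> {} = 0"
    and "\<And>i. integrable (measure_pmf serv) (\<lambda>s. (real (s $ i))\<^sup>2)"
    and "\<mu> = service_rate serv"
    and "total_rate \<mu> > 0"
    and "\<And>l. l \<in> {0<..<total_rate \<mu>} \<Longrightarrow> integrable (measure_pmf (arr l)) (\<lambda>a. (real a)\<^sup>2)"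
    and "\<And>l. l \<in> {0<..<total_rate \<mu>} \<Longrightarrow> measure_pmf.expectation (arr l) real = l"
    and "\<And>l. l \<in> {0<..<total_rate \<mu>} \<Longrightarrow>
           irreducible_on (input_space (arr l) serv (R_rnd \<pi>)) (queue R_route) (E l)"
    and "\<And>\<tau>. bij_betw \<tau> {1..CARD('n)} (UNIV :: 'n set) \<Longrightarrow> \<mu> \<in> M_tau \<pi> \<tau>"
  shows "throughput_optimal serv arr E (R_rnd \<pi>) R_route"
  unfolding throughput_optimal_def interior_capacity_region
proof
  fix l assume "l \<in> {0<..<total_rate (service_rate serv)}"
  then have l: "l \<in> {0<..<total_rate \<mu>}" by (simp add: assms(3))
  let ?T = "total_rate \<mu>"
  let ?J = "pair_pmf (arr l) (pair_pmf serv (R_rnd \<pi>))"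
  interpret random_map_chain ?J queue_step "queue R_route"
    by unfold_locales (simp_all add: queue_step_def Let_def case_prod_unfold)
  have S_eq: "input_space (arr l) serv (R_rnd \<pi>) = S" by (simp add: input_space_def)
  have irr: "irreducible_on S (queue R_route) (E l)" using assms(7)[OF l] by (simp only: S_eq)

  have serv_int: "integrable (measure_pmf serv) (\<lambda>s. real (s $ i))" for i
    by (rule integrable_of_square_pmf) (rule assms(2))
  have \<mu>: "\<mu> $ i = measure_pmf.expectation serv (\<lambda>s. real (s $ i))" for i
    by (simp add: assms(3) service_rate_def)
  have \<mu>_nonneg: "0 \<le> \<mu> $ i" for i by (simp add: \<mu>)

  define D where "D q = (\<Sum>i\<in>UNIV. \<mu> $ i * real (q $ i))" for q
  have D_nonneg: "0 \<le> D q" for q by (auto simp: D_def \<mu>_nonneg intro!: sum_nonneg)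
  define \<rho> where "\<rho> = l / ?T"
  have \<rho>: "0 \<le> \<rho>" "\<rho> < 1" using l by (auto simp: \<rho>_def)

  have arrivals: "(\<integral>\<^sup>+a. of_nat a \<partial>arr l) = ennreal l"
    using nn_integral_of_nat_pmf[of "arr l" "\<lambda>a. a"] integrable_of_square_pmf[of "arr l" "\<lambda>a. a"]
      assms(5)[OF l] assms(6)[OF l] by simp
  have services: "(\<integral>\<^sup>+s. of_nat (2 * (\<Sum>i\<in>UNIV. q $ i * s $ i)) \<partial>serv) = ennreal (2 * D q)" for q
  proof -
    have "measure_pmf.expectation serv (\<lambda>s. real (2 * (\<Sum>i\<in>UNIV. q $ i * s $ i))) = 2 * D q"
      using serv_int by (simp add: D_def \<mu> mult.commute)
    then show ?thesis using serv_int by (subst nn_integral_of_nat_pmf) auto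
  qed
  define C where "C = measure_pmf.expectation (arr l) (\<lambda>a. real (a\<^sup>2))
    + measure_pmf.expectation serv (\<lambda>s. real (sq_norm s))"
  have C_nonneg: "0 \<le> C" by (simp add: C_def)
  have second_moments: "(\<integral>\<^sup>+a. of_nat (a\<^sup>2) \<partial>arr l) + (\<integral>\<^sup>+s. of_nat (sq_norm s) \<partial>serv) = ennreal C"
    unfolding C_def using assms(2) assms(5)[OF l]
    by (subst (1 2) nn_integral_of_nat_pmf) (auto simp: sq_norm_def sum_nonneg simp flip: ennreal_plus)
  have subset: "measure_pmf.prob \<pi> {S. S \<subseteq> A} * ?T \<le> (\<Sum>i\<in>A. \<mu> $ i)" for A
    using assms(8,4,1) by (rule prob_subset_le)
  have routing: "ennreal l * (\<integral>\<^sup>+r. of_nat (q $ R_route q r) \<partial>R_rnd \<pi>) \<le> ennreal (\<rho> * D q)" for q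
  proof -
    \<comment> \<open>\<open>expected_route_le\<close> concerns arrivals at the full rate
      \<open>?T\<close>; the actual rate is the fraction \<open>\<rho>\<close> of it.\<close>
    have "ennreal l = ennreal \<rho> * ennreal ?T"
      using \<rho> l by (simp add: \<rho>_def flip: ennreal_mult)
    then have "ennreal l * (\<integral>\<^sup>+r. of_nat (q $ R_route q r) \<partial>R_rnd \<pi>)
        = ennreal \<rho> * (ennreal ?T * (\<integral>\<^sup>+r. of_nat (q $ R_route q r) \<partial>R_rnd \<pi>))"
      by (simp add: mult.assoc)
    also have "\<dots> \<le> ennreal \<rho> * ennreal (D q)"
      unfolding D_def using expected_route_le[OF subset less_imp_le[OF assms(4)] assms(1), of q]
      by (rule mult_left_mono) simp
    finally show ?thesis using \<rho> D_nonneg by (simp add: ennreal_mult)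
  qed

  let ?PV = "\<lambda>q. \<integral>\<^sup>+i. of_nat (sq_norm (queue_step q i)) \<partial>?J"
  have drift: "?PV q + ennreal (2 * (1 - \<rho>) * D q) \<le> of_nat (sq_norm q) + ennreal C" for q
  proof -
    \<comment> \<open>The service term \<open>2 * D q\<close> is split: the share
      \<open>\<rho>\<close> pays for the routed arrivals and cancels, the share
      \<open>1 - \<rho>\<close> remains as negative drift.\<close>
    have "ennreal (2 * (1 - \<rho>) * D q) + ennreal (2 * \<rho> * D q) = ennreal (2 * (1 - \<rho>) * D q + 2 * \<rho> * D q)"
      using \<rho> D_nonneg[of q] by (intro ennreal_plus[symmetric]) auto
    also have "2 * (1 - \<rho>) * D q + 2 * \<rho> * D q = 2 * D q"
      by (simp add: algebra_simps)
    finally have "(?PV q + ennreal (2 * (1 - \<rho>) * D q)) + ennreal (2 * \<rho> * D q) = ?PV q + ennreal (2 * D q)"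
      by (simp only: add.assoc)
    also have "\<dots> \<le> of_nat (sq_norm q)
        + 2 * (ennreal l * (\<integral>\<^sup>+r. of_nat (q $ R_route q r) \<partial>R_rnd \<pi>)) + ennreal C"
      using queue_step_drift[where q = q and arr = "arr l" and serv = serv and rnd = "R_rnd \<pi>"]
      unfolding services arrivals second_moments by (simp add: mult.assoc)
    also have "\<dots> \<le> of_nat (sq_norm q) + 2 * ennreal (\<rho> * D q) + ennreal C"
      by (intro add_mono mult_left_mono routing) auto
    also have "2 * ennreal (\<rho> * D q) = ennreal (2 * \<rho> * D q)"
      using \<rho> D_nonneg[of q] by (simp add: ennreal_mult' mult.assoc)
    finally have "ennreal (2 * \<rho> * D q) + (?PV q + ennreal (2 * (1 - \<rho>) * D q))
        \<le> ennreal (2 * \<rho> * D q) + (of_nat (sq_norm q) + ennreal C)"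
      by (simp only: ac_simps)
    then show ?thesis unfolding ennreal_add_left_cancel_le by simp
  qed

  \<comment> \<open>Outside \<open>B\<close> the negative drift beats \<open>C\<close> by at least
    the 1 that Foster's criterion asks for; inside, \<open>C + 1\<close> covers the defect.\<close>
  define B where "B = {q. 2 * (1 - \<rho>) * D q < C + 1}"
  show "positive_recurrent_on (input_space (arr l) serv (R_rnd \<pi>)) (queue R_route) (E l)"
    unfolding S_eq
  proof (rule foster_positive_recurrent[OF irr, of B "C + 1" "\<lambda>q. of_nat (sq_norm q)"])
    \<comment> \<open>A nonnegative variable with mean 0 vanishes on the support of its law.\<close>
    have unserved: "s $ i = 0" if "\<mu> $ i = 0" "s \<in> set_pmf serv" for s i
      using that serv_int[of i] unfolding \<mu>
      by (subst (asm) integral_nonneg_eq_0_iff_AE) (auto simp: AE_measure_pmf_iff)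
    have const: "x $ i \<le> y $ i" if "x \<in> E l" "y \<in> E l" "\<mu> $ i = 0" for x y i
      by (rule irreducible_on_mono[OF irr that(1,2), of "\<lambda>q. q $ i"])
         (auto simp: queue_step_def next_queue_nth unserved[OF that(3)])
    obtain x0 where x0: "x0 \<in> E l" using irr by (auto simp: irreducible_on_def)
    \<comment> \<open>An upper bound of \<open>D\<close> on \<open>B\<close>. Dividing it by
      \<open>\<mu> $ i\<close> bounds each queue with positive service rate; the others are bounded
      by their value in \<open>x0\<close>.\<close>
    define K where "K = (C + 1) / (2 * (1 - \<rho>))"
    have "B \<inter> E l \<subseteq> {q. \<forall>i. q $ i \<le> (if \<mu> $ i = 0 then x0 $ i else nat \<lceil>K / \<mu> $ i\<rceil>)}"
    proof safe
      fix q i assume q: "q \<in> B" "q \<in> E l"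
      show "q $ i \<le> (if \<mu> $ i = 0 then x0 $ i else nat \<lceil>K / \<mu> $ i\<rceil>)"
      proof (cases "\<mu> $ i = 0")
        case False
        have "\<mu> $ i * real (q $ i) \<le> D q"
          unfolding D_def by (rule member_le_sum) (auto simp: \<mu>_nonneg)
        also have "\<dots> \<le> K" using q(1) \<rho> by (simp add: B_def K_def field_simps)
        finally have "real (q $ i) \<le> K / \<mu> $ i"
          using False \<mu>_nonneg[of i] by (simp add: field_simps)
        also have "\<dots> \<le> real (nat \<lceil>K / \<mu> $ i\<rceil>)" by (rule real_nat_ceiling_ge)
        finally show ?thesis using False by simp
      qed (use const[OF q(2) x0] in simp)
    qed
    then show "finite (B \<inter> E l)" by (rule finite_subset) (rule finite_vec_bounded)
    show "0 \<le> C + 1" using C_nonneg by simp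
    show "of_nat (sq_norm q) < (\<infinity> :: ennreal)" for q
      by (simp add: of_nat_less_top)
    show "?PV q + 1 \<le> of_nat (sq_norm q) + ennreal (C + 1) * indicator B q" for q
    proof (cases "q \<in> B")
      case True
      have "?PV q + 1 \<le> (?PV q + ennreal (2 * (1 - \<rho>) * D q)) + 1" by (intro add_right_mono) simp
      also have "\<dots> \<le> of_nat (sq_norm q) + ennreal C + 1" by (intro add_right_mono drift)
      finally show ?thesis using True C_nonneg by (simp add: add.assoc)
    next
      case False
      then have "C + 1 \<le> 2 * (1 - \<rho>) * D q" by (simp add: B_def)
      then have "ennreal C + 1 \<le> ennreal (2 * (1 - \<rho>) * D q)"
        using C_nonneg by (metis ennreal_1 ennreal_leI ennreal_plus zero_le_one)
      then have "?PV q + (ennreal C + 1) \<le> of_nat (sq_norm q) + ennreal C"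
        using drift[of q] by (meson add_left_mono order_trans)
      then have "ennreal C + (?PV q + 1) \<le> ennreal C + of_nat (sq_norm q)"
        by (simp add: ac_simps)
      then show ?thesis using False by (simp add: ennreal_add_left_cancel_le)
    qed
  qed
qed

end
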